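(* Let $R$ be a characteristic range set and let $Z$ be a discrete topological space of cardinality $\aleph_1$. Then $\mathrm{UMet}(Z;R)$ is not a Borel subset of $\mathrm{UCPM}(Z;R)$.
   Context: A range set is a set $R\subseteq[0,\infty)$ with $0\in R$; it is characteristic if for every $t>0$ there exists $r\in R\setminus\{0\}$ with $r\le t$. Write $a\lor b=\max\{a,b\}$. For a topological space $X$, an $R$-valued continuous pseudo-ultrametric on $X$ is a continuous map $d\colon X\times X\to[0,\infty)$ with $d(x,x)=0$, $d(x,y)=d(y,x)$, $d(x,z)\le d(x,y)\lor d(y,z)$ for all $x,y,z\in X$, and $d(X^2)\subseteq R$. $\mathrm{UCPM}(X;R)$ is the set of all of these, equipped with the topology induced by the ($[0,\infty]$-valued) metric $\mathcal{UD}_X^R(d,e)=\inf\{\varepsilon\in R\cup\{\infty\} : d(x,y)\le e(x,y)\lor\varepsilon \text{ and } e(x,y)\le d(x,y)\lor\varepsilon \text{ for all } x,y\in X\}$. $\mathrm{UMet}(X;R)\subseteq\mathrm{UCPM}(X;R)$ is the set of all $R$-valued ultrametrics on $X$ that induce the topology of $X$. *)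

theory Defs
  imports "HOL-Analysis.Analysis"
begin

unbundle cardinal_syntax

definition range_set :: "real set \<Rightarrow> bool" where
  "range_set R \<longleftrightarrow> R \<subseteq> {0..} \<and> 0 \<in> R"

definition characteristic_range_set :: "real set \<Rightarrow> bool" where
  "characteristic_range_set R \<longleftrightarrow> range_set R \<and> (\<forall>t>0. \<exists>r\<in>R - {0}. r \<le> t)"

text \<open>The first conjunct is only an encoding convention: it makes \<open>d\<close> determined by its values on
  \<open>M \<times> M\<close>, so that equality of HOL functions is equality of maps on \<open>M \<times> M\<close>. The junk value \<open>0\<close>
  is the one compatible with the locale \<^locale>\<open>Metric_space\<close>, which asks for nonnegativity and
  symmetry also outside the carrier.\<close>

definition pseudo_ultrametric_on :: "'a set \<Rightarrow> ('a \<Rightarrow> 'a \<Rightarrow> real) \<Rightarrow> bool" where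
  "pseudo_ultrametric_on M d \<longleftrightarrow>
     (\<forall>x y. x \<notin> M \<or> y \<notin> M \<longrightarrow> d x y = 0) \<and>
     (\<forall>x\<in>M. \<forall>y\<in>M. 0 \<le> d x y) \<and>
     (\<forall>x\<in>M. d x x = 0) \<and>
     (\<forall>x\<in>M. \<forall>y\<in>M. d x y = d y x) \<and>
     (\<forall>x\<in>M. \<forall>y\<in>M. \<forall>z\<in>M. d x z \<le> max (d x y) (d y z))"

definition UCPM :: "'a topology \<Rightarrow> real set \<Rightarrow> ('a \<Rightarrow> 'a \<Rightarrow> real) set" where
  "UCPM X R = {d. pseudo_ultrametric_on (topspace X) d \<and>
     continuous_map (prod_topology X X) (top_of_set {0..}) (\<lambda>(x, y). d x y) \<and>
     (\<forall>x\<in>topspace X. \<forall>y\<in>topspace X. d x y \<in> R)}"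

definition UMet :: "'a topology \<Rightarrow> real set \<Rightarrow> ('a \<Rightarrow> 'a \<Rightarrow> real) set" where
  "UMet X R = {d \<in> UCPM X R.
     Metric_space (topspace X) d \<and> Metric_space.mtopology (topspace X) d = X}"

definition UD ::
    "'a topology \<Rightarrow> real set \<Rightarrow> ('a \<Rightarrow> 'a \<Rightarrow> real) \<Rightarrow> ('a \<Rightarrow> 'a \<Rightarrow> real) \<Rightarrow> ennreal" where
  "UD X R d e = Inf {\<epsilon> \<in> ennreal ` R \<union> {\<infinity>}. \<forall>x\<in>topspace X. \<forall>y\<in>topspace X.
     ennreal (d x y) \<le> max (ennreal (e x y)) \<epsilon> \<and> ennreal (e x y) \<le> max (ennreal (d x y)) \<epsilon>}"

definition UCPM_topology :: "'a topology \<Rightarrow> real set \<Rightarrow> ('a \<Rightarrow> 'a \<Rightarrow> real) topology" where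
  "UCPM_topology X R = topology (\<lambda>U. U \<subseteq> UCPM X R \<and>
     (\<forall>d\<in>U. \<exists>\<epsilon>>0. {e \<in> UCPM X R. UD X R d e < \<epsilon>} \<subseteq> U))"

lemma openin_UCPM_topology:
  "openin (UCPM_topology X R) U \<longleftrightarrow> U \<subseteq> UCPM X R \<and>
     (\<forall>d\<in>U. \<exists>\<epsilon>>0. {e \<in> UCPM X R. UD X R d e < \<epsilon>} \<subseteq> U)"
proof -
  have "istopology (\<lambda>U. U \<subseteq> UCPM X R \<and>
     (\<forall>d\<in>U. \<exists>\<epsilon>>0. {e \<in> UCPM X R. UD X R d e < \<epsilon>} \<subseteq> U))" (is "istopology ?P")
    unfolding istopology_def
  proof (intro conjI allI impI)
    fix S T assume S: "?P S" and T: "?P T"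
    show "S \<inter> T \<subseteq> UCPM X R" using S by blast
    show "\<forall>d\<in>S \<inter> T. \<exists>\<epsilon>>0. {e \<in> UCPM X R. UD X R d e < \<epsilon>} \<subseteq> S \<inter> T"
    proof
      fix d assume "d \<in> S \<inter> T"
      then obtain a b where "a > 0" "{e \<in> UCPM X R. UD X R d e < a} \<subseteq> S"
        and "b > 0" "{e \<in> UCPM X R. UD X R d e < b} \<subseteq> T"
        using S T by blast
      then show "\<exists>\<epsilon>>0. {e \<in> UCPM X R. UD X R d e < \<epsilon>} \<subseteq> S \<inter> T"
        by (intro exI[of _ "min a b"]) auto
    qed
  next
    fix \<K> assume K: "\<forall>K\<in>\<K>. ?P K"
    show "\<Union>\<K> \<subseteq> UCPM X R" using K by blast
    show "\<forall>d\<in>\<Union>\<K>. \<exists>\<epsilon>>0. {e \<in> UCPM X R. UD X R d e < \<epsilon>} \<subseteq> \<Union>\<K>"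
    proof
      fix d assume "d \<in> \<Union>\<K>"
      then obtain K where "K \<in> \<K>" "d \<in> K" by blast
      then obtain a where "a > 0" "{e \<in> UCPM X R. UD X R d e < a} \<subseteq> K" using K by blast
      with \<open>K \<in> \<K>\<close> show "\<exists>\<epsilon>>0. {e \<in> UCPM X R. UD X R d e < \<epsilon>} \<subseteq> \<Union>\<K>"
        by blast
    qed
  qed
  then show ?thesis by (simp add: UCPM_topology_def topology_inverse')
qed

lemma topspace_UCPM_topology: "topspace (UCPM_topology X R) = UCPM X R"
proof (rule antisym)
  show "topspace (UCPM_topology X R) \<subseteq> UCPM X R"
    by (auto simp: topspace_def openin_UCPM_topology)
  have "openin (UCPM_topology X R) (UCPM X R)"
    unfolding openin_UCPM_topology by (auto intro!: exI[of _ 1])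
  then show "UCPM X R \<subseteq> topspace (UCPM_topology X R)" by (rule openin_subset)
qed

definition borel_sets_of :: "'a topology \<Rightarrow> 'a set set" where
  "borel_sets_of T = sigma_sets (topspace T) {U. openin T U}"

end

theory Submission
  imports Defs "HOL-Library.Countable_Set_Type"
begin

text \<open>
  Baire space \<open>\<nat> \<Rightarrow> \<nat>\<close> serves as a test space. Given \<open>b : Z \<rightarrow> (\<nat> \<Rightarrow> \<nat>)\<close> whose nonempty fibres all have at
  least two points, assign to \<open>x\<close> the pseudo-ultrametric in which points of different fibres have
  distance \<open>r 0\<close>, and distinct points of the fibre over \<open>y\<close> have distance \<open>r n\<close>, where \<open>n\<close> is the first
  index with \<open>x n \<noteq> y n\<close>, or \<open>0\<close> if \<open>x = y\<close>. This depends continuously on \<open>x\<close> and is an ultrametric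
  inducing the discrete topology iff \<open>x \<notin> range b\<close>. So if \<open>UMet\<close> were Borel, every nonempty set of at
  most \<open>\<aleph>\<^sub>1\<close> points of Baire space would be Borel, hence analytic. But there is a non-analytic set
  \<open>D\<close>, by diagonalisation. If \<open>|D| \<le> \<aleph>\<^sub>1\<close> this is a contradiction at once; otherwise a subset of size
  \<open>\<aleph>\<^sub>1 < |D|\<close> would be uncountable and analytic, hence of the size of the continuum by the perfect set
  theorem, which is at least \<open>|D|\<close>.
\<close>

section \<open>Cylinders and the topology of Baire space\<close>

definition cyl :: "nat \<Rightarrow> (nat \<Rightarrow> 'a) \<Rightarrow> (nat \<Rightarrow> 'a) set" where
  "cyl n x = {y. \<forall>i<n. y i = x i}"

lemma cyl_self [simp]: "x \<in> cyl n x"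
  by (simp add: cyl_def)

lemma cyl_mono: "m \<le> n \<Longrightarrow> cyl n x \<subseteq> cyl m x"
  by (auto simp: cyl_def)

lemma cyl_eq: "y \<in> cyl n x \<Longrightarrow> cyl n y = cyl n x"
  by (auto simp: cyl_def)

lemma open_cyl: "open (cyl n (x :: nat \<Rightarrow> nat))"
  using product_topology_basis'[of "{..<n}" "\<lambda>i. {x i}" "\<lambda>i. i"]
  by (simp add: cyl_def open_discrete Ball_def)

lemma open_Baire_iff: "open S \<longleftrightarrow> (\<forall>x\<in>S. \<exists>n. cyl n x \<subseteq> S)"
  for S :: "(nat \<Rightarrow> nat) set"
proof
  assume "open S"
  show "\<forall>x\<in>S. \<exists>n. cyl n x \<subseteq> S"
  proof
    fix x assume "x \<in> S"
    then obtain U where U: "finite {i. U i \<noteq> UNIV}" "x \<in> Pi\<^sub>E UNIV U" "Pi\<^sub>E UNIV U \<subseteq> S"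
      using \<open>open S\<close> unfolding open_fun_def openin_product_topology_alt by force
    obtain n where n: "\<And>i. U i \<noteq> UNIV \<Longrightarrow> i < n"
      using U(1) finite_nat_set_iff_bounded by auto
    have "cyl n x \<subseteq> Pi\<^sub>E UNIV U"
      using U(2) n by (fastforce simp: cyl_def PiE_iff)
    with U(3) show "\<exists>n. cyl n x \<subseteq> S" by blast
  qed
next
  assume R: "\<forall>x\<in>S. \<exists>n. cyl n x \<subseteq> S"
  show "open S"
  proof (subst open_subopen, intro ballI)
    fix x assume "x \<in> S"
    then obtain n where "cyl n x \<subseteq> S" using R by blast
    then show "\<exists>T. open T \<and> x \<in> T \<and> T \<subseteq> S"
      using open_cyl[of n x] cyl_self[of x n] by blast
  qed
qed

text \<open>One common length serves both factors because longer cylinders are smaller. Closedness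
  of a set of pairs is checked below by applying this criterion to its complement.\<close>

lemma open_Baire_prod_iff: "open S \<longleftrightarrow> (\<forall>x z. (x, z) \<in> S \<longrightarrow> (\<exists>n. cyl n x \<times> cyl n z \<subseteq> S))"
  for S :: "((nat \<Rightarrow> nat) \<times> (nat \<Rightarrow> nat)) set"
proof
  assume "open S"
  show "\<forall>x z. (x, z) \<in> S \<longrightarrow> (\<exists>n. cyl n x \<times> cyl n z \<subseteq> S)"
  proof (intro allI impI)
    fix x z assume "(x, z) \<in> S"
    then obtain A B where AB: "open A" "open B" "x \<in> A" "z \<in> B" "A \<times> B \<subseteq> S"
      using \<open>open S\<close> by (auto elim: open_prod_elim)
    then obtain m n where "cyl m x \<subseteq> A" "cyl n z \<subseteq> B"
      unfolding open_Baire_iff by blast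
    then have "cyl (max m n) x \<times> cyl (max m n) z \<subseteq> S"
      using AB(5) cyl_mono[of m "max m n" x] cyl_mono[of n "max m n" z] by fastforce
    then show "\<exists>n. cyl n x \<times> cyl n z \<subseteq> S" ..
  qed
next
  assume R: "\<forall>x z. (x, z) \<in> S \<longrightarrow> (\<exists>n. cyl n x \<times> cyl n z \<subseteq> S)"
  show "open S"
  proof (subst open_subopen, intro ballI)
    fix p assume "p \<in> S"
    then obtain n where "cyl n (fst p) \<times> cyl n (snd p) \<subseteq> S"
      using R by (metis prod.collapse)
    then show "\<exists>T. open T \<and> p \<in> T \<and> T \<subseteq> S"
      by (intro exI[of _ "cyl n (fst p) \<times> cyl n (snd p)"] conjI)
        (simp_all add: open_Times open_cyl mem_Times_iff)
  qed
qed

section \<open>Analytic sets, and a set that is not analytic\<close>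

text \<open>Projections, unlike continuous images of the whole Baire space, include the empty set,
  and they reduce the enumeration of analytic sets to that of closed sets.\<close>

definition analytic :: "(nat \<Rightarrow> nat) set \<Rightarrow> bool" where
  "analytic A \<longleftrightarrow> (\<exists>C :: ((nat \<Rightarrow> nat) \<times> (nat \<Rightarrow> nat)) set. closed C \<and> A = fst ` C)"

lemma analytic_closed: "closed A \<Longrightarrow> analytic A"
  unfolding analytic_def by (intro exI[of _ "A \<times> UNIV"]) (auto intro: closed_Times)

lemma analytic_open:
  assumes "open U" shows "analytic U"
proof -
  \<comment> \<open>The witness \<open>z 0\<close> is the length of a cylinder around
    \<open>x\<close> inside \<open>U\<close>. Membership depends only on \<open>z 0\<close> and the
    first \<open>z 0\<close> coordinates of \<open>x\<close>, so the complement is open.\<close>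
  let ?C = "{(x, z :: nat \<Rightarrow> nat). cyl (z 0) x \<subseteq> U}"
  have "open (- ?C)"
    unfolding open_Baire_prod_iff
  proof (intro allI impI)
    fix x z :: "nat \<Rightarrow> nat" assume xz: "(x, z) \<in> - ?C"
    have "(y, w) \<in> - ?C" if "y \<in> cyl (Suc (z 0)) x" "w \<in> cyl (Suc (z 0)) z" for y w
    proof -
      have "w 0 = z 0" "y \<in> cyl (z 0) x" using that by (auto simp: cyl_def)
      then show ?thesis using xz cyl_eq by force
    qed
    then show "\<exists>n. cyl n x \<times> cyl n z \<subseteq> - ?C" by blast
  qed
  moreover have "U = fst ` ?C"
  proof
    show "U \<subseteq> fst ` ?C"
    proof
      fix x assume "x \<in> U"
      then obtain n where "cyl n x \<subseteq> U" using assms open_Baire_iff by blast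
      then show "x \<in> fst ` ?C" by (intro image_eqI[of _ _ "(x, \<lambda>_. n)"]) auto
    qed
    show "fst ` ?C \<subseteq> U" using cyl_self by fastforce
  qed
  ultimately show ?thesis by (auto simp: analytic_def closed_def)
qed

lemma analytic_UN:
  assumes "\<And>i::nat. analytic (A i)" shows "analytic (\<Union>i. A i)"
proof -
  obtain C :: "nat \<Rightarrow> ((nat \<Rightarrow> nat) \<times> (nat \<Rightarrow> nat)) set"
    where C: "\<And>i. closed (C i)" "\<And>i. A i = fst ` C i"
    using assms unfolding analytic_def by metis
  \<comment> \<open>\<open>z 0\<close> selects a member of the family, and the shifted tail of
    \<open>z\<close> is the witness for it.\<close>
  let ?C = "{(x, z :: nat \<Rightarrow> nat). (x, \<lambda>k. z (Suc k)) \<in> C (z 0)}"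
  have "open (- ?C)"
    unfolding open_Baire_prod_iff
  proof (intro allI impI)
    fix x z :: "nat \<Rightarrow> nat" assume "(x, z) \<in> - ?C"
    then have "(x, \<lambda>k. z (Suc k)) \<in> - C (z 0)" by simp
    then obtain n where n: "cyl n x \<times> cyl n (\<lambda>k. z (Suc k)) \<subseteq> - C (z 0)"
      using C(1) unfolding closed_def open_Baire_prod_iff by meson
    have "(y, w) \<in> - ?C" if "y \<in> cyl (Suc n) x" "w \<in> cyl (Suc n) z" for y w
    proof -
      have "w 0 = z 0" "(y, \<lambda>k. w (Suc k)) \<in> cyl n x \<times> cyl n (\<lambda>k. z (Suc k))"
        using that by (auto simp: cyl_def)
      then show ?thesis using n by auto
    qed
    then show "\<exists>n. cyl n x \<times> cyl n z \<subseteq> - ?C" by blast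
  qed
  moreover have "(\<Union>i. A i) = fst ` ?C"
  proof
    show "(\<Union>i. A i) \<subseteq> fst ` ?C"
    proof
      fix x assume "x \<in> (\<Union>i. A i)"
      then obtain i z where "(x, z) \<in> C i" using C(2) by auto
      then show "x \<in> fst ` ?C" by (intro image_eqI[of _ _ "(x, case_nat i z)"]) auto
    qed
    show "fst ` ?C \<subseteq> (\<Union>i. A i)" using C(2) by force
  qed
  ultimately show ?thesis unfolding analytic_def closed_def by blast
qed

lemma analytic_INT:
  assumes "\<And>i::nat. analytic (A i)" shows "analytic (\<Inter>i. A i)"
proof -
  obtain C :: "nat \<Rightarrow> ((nat \<Rightarrow> nat) \<times> (nat \<Rightarrow> nat)) set"
    where C: "\<And>i. closed (C i)" "\<And>i. A i = fst ` C i"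
    using assms unfolding analytic_def by metis
  \<comment> \<open>A single \<open>z\<close> codes one witness for every \<open>i\<close>, read off
    along row \<open>i\<close> of the pairing function.\<close>
  let ?g = "\<lambda>i p :: (nat \<Rightarrow> nat) \<times> (nat \<Rightarrow> nat). (fst p, \<lambda>k. snd p (prod_encode (i, k)))"
  let ?C = "\<Inter>i. ?g i -` C i"
  have "continuous_on UNIV (\<lambda>p :: (nat \<Rightarrow> nat) \<times> (nat \<Rightarrow> nat). snd p j)" for j
    by (rule continuous_on_compose2[OF continuous_on_product_coordinates[of j] continuous_on_snd])
      (auto intro: continuous_on_id)
  then have "continuous_on UNIV (?g i)" for i
    by (intro continuous_intros)
  then have "closed ?C" using C(1) by (intro closed_INT ballI closed_vimage)
  moreover have "(\<Inter>i. A i) = fst ` ?C"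
  proof
    show "(\<Inter>i. A i) \<subseteq> fst ` ?C"
    proof
      fix x assume "x \<in> (\<Inter>i. A i)"
      then have "\<forall>i. \<exists>z. (x, z) \<in> C i" using C(2) by fastforce
      then obtain z where "\<And>i. (x, z i) \<in> C i" by metis
      then show "x \<in> fst ` ?C"
        by (intro image_eqI[of _ _ "(x, \<lambda>m. z (fst (prod_decode m)) (snd (prod_decode m)))"]) auto
    qed
    show "fst ` ?C \<subseteq> (\<Inter>i. A i)" using C(2) by force
  qed
  ultimately show ?thesis unfolding analytic_def by blast
qed

text \<open>Analyticity need not pass to complements, so the induction runs over sets that are
  analytic together with their complement; for the complement, unions turn into
  intersections.\<close>

lemma borel_imp_analytic:
  assumes "A \<in> sigma_sets UNIV {U :: (nat \<Rightarrow> nat) set. open U}"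
  shows "analytic A"
proof -
  have "analytic A \<and> analytic (- A)"
    using assms
  proof induction
    case (Basic U)
    then show ?case by (auto intro: analytic_open analytic_closed)
  next
    case Empty
    then show ?case by (auto intro: analytic_open)
  next
    case (Compl U)
    then show ?case by (simp add: Compl_eq_Diff_UNIV[symmetric])
  next
    case (Union U)
    then show ?case by (simp add: analytic_UN analytic_INT)
  qed
  then show ?thesis ..
qed

lemma ex_not_analytic: "\<exists>D. \<not> analytic D"
proof -
  obtain B :: "((nat \<Rightarrow> nat) \<times> (nat \<Rightarrow> nat)) set set"
    where B: "countable B" "\<And>S. open S \<Longrightarrow> \<exists>\<U>. \<U> \<subseteq> B \<and> S = \<Union>\<U>"
    using univ_second_countable by metis
  \<comment> \<open>Inserting the empty set makes the family nonempty, as its enumeration requires,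
    and changes no union.\<close>
  define b where "b = from_nat_into (insert {} B)"
  have b: "range b = insert {} B"
    unfolding b_def using B(1) by (intro range_from_nat_into) auto
  \<comment> \<open>\<open>C\<close> enumerates all closed sets by points of Baire space.\<close>
  define C where "C x = - (\<Union>i. b (x i))" for x :: "nat \<Rightarrow> nat"
  have C: "\<exists>x. K = C x" if K: "closed K" for K
  proof -
    obtain \<U> where \<U>: "\<U> \<subseteq> B" "- K = \<Union>\<U>" using B(2) K by blast
    have "countable \<U>" using \<U>(1) B(1) countable_subset by blast
    then have r: "range (from_nat_into (insert {} \<U>)) = insert {} \<U>"
      by (intro range_from_nat_into) auto
    then have "\<forall>i. \<exists>j. from_nat_into (insert {} \<U>) i = b j"
      using \<U>(1) b by (metis (no_types, lifting) imageE insert_iff rangeI subset_iff)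
    then obtain x where x: "\<And>i. from_nat_into (insert {} \<U>) i = b (x i)" by metis
    have "(\<Union>i. b (x i)) = \<Union>(range (from_nat_into (insert {} \<U>)))"
      using x by simp
    also have "\<dots> = - K" using r \<U>(2) by simp
    finally show ?thesis unfolding C_def by blast
  qed
  \<comment> \<open>Cantor's diagonal set: a code \<open>x\<close> of a closed set projecting onto
    it would belong to it iff it does not.\<close>
  let ?D = "{x. x \<notin> fst ` C x}"
  have "\<not> analytic ?D"
  proof
    assume "analytic ?D"
    then obtain x where "?D = fst ` C x" unfolding analytic_def using C by metis
    then show False by blast
  qed
  then show ?thesis ..
qed

section \<open>The perfect set theorem\<close>

text \<open>A Cantor scheme: a binary tree of points of \<open>K\<close> with growing lengths, where
  both children lie in the cylinders of their parent and siblings have disjoint cylinders in the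
  first coordinate. Branches converge in \<open>K\<close>, and different branches have limits with
  different first coordinates.\<close>

lemma perfect_scheme:
  fixes K :: "((nat \<Rightarrow> nat) \<times> (nat \<Rightarrow> nat)) set"
  assumes "closed K" "K \<noteq> {}"
    and split: "\<And>x z n. (x, z) \<in> K \<Longrightarrow>
      \<exists>p\<in>K \<inter> cyl n x \<times> cyl n z. \<exists>q\<in>K \<inter> cyl n x \<times> cyl n z. fst p \<noteq> fst q"
  shows "\<exists>f :: (nat \<Rightarrow> bool) \<Rightarrow> (nat \<Rightarrow> nat). inj f \<and> range f \<subseteq> fst ` K"
proof -
  \<comment> \<open>Nodes are pairs of a point and a length. The condition is vacuous for points
    outside \<open>K\<close>, so that \<open>G\<close> can be chosen for all nodes at once.\<close>
  define good where "good t G \<longleftrightarrow> (\<forall>x z n. t = ((x, z), n) \<longrightarrow> (x, z) \<in> K \<longrightarrow>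
       (\<forall>i. fst (G i) \<in> K \<inter> cyl n x \<times> cyl n z \<and> n < snd (G i)) \<and>
       cyl (snd (G True)) (fst (fst (G True))) \<inter> cyl (snd (G False)) (fst (fst (G False))) = {})"
    for t and G :: "bool \<Rightarrow> ((nat \<Rightarrow> nat) \<times> (nat \<Rightarrow> nat)) \<times> nat"
  have "\<exists>G. good t G" for t
  proof -
    obtain x z n where t: "t = ((x, z), n)" by (metis surj_pair)
    show ?thesis
    proof (cases "(x, z) \<in> K")
      case True
      then obtain p q where pq: "p \<in> K \<inter> cyl n x \<times> cyl n z" "q \<in> K \<inter> cyl n x \<times> cyl n z"
        "fst p \<noteq> fst q" using split by blast
      then obtain m where m: "fst p m \<noteq> fst q m" by blast
      \<comment> \<open>Exceeding \<open>m\<close> separates the two cylinders; exceeding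
        \<open>n\<close> makes the lengths grow strictly.\<close>
      define N where "N = Suc (max m n)"
      have "cyl N (fst p) \<inter> cyl N (fst q) = {}"
      proof -
        have "m < N" by (simp add: N_def)
        then show ?thesis using m unfolding cyl_def by fastforce
      qed
      then show ?thesis
        using pq(1,2) t unfolding good_def
        by (intro exI[of _ "\<lambda>i. (if i then p else q, N)"]) (simp add: N_def less_Suc_eq_le)
    qed (use t in \<open>simp add: good_def\<close>)
  qed
  then obtain G where "\<And>t. good t (G t)" by metis
  note good = good_def[THEN iffD1, OF this, rule_format, OF refl]
  have G: "fst (G ((x, z), n) i) \<in> K \<inter> cyl n x \<times> cyl n z"
      "n < snd (G ((x, z), n) i)"
      "cyl (snd (G ((x, z), n) True)) (fst (fst (G ((x, z), n) True))) \<inter>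
         cyl (snd (G ((x, z), n) False)) (fst (fst (G ((x, z), n) False))) = {}"
    if "(x, z) \<in> K" for x z n i
    using good[OF that, of n] by simp_all
  obtain p0 where p0: "p0 \<in> K" using assms(2) by blast
  \<comment> \<open>The node reached after \<open>k\<close> steps along the branch
    \<open>h\<close>.\<close>
  define N where "N h = rec_nat (p0, 0::nat) (\<lambda>n t. G t (h n))" for h :: "nat \<Rightarrow> bool"
  have N0: "N h 0 = (p0, 0)" and NS: "N h (Suc k) = G (N h k) (h k)" for h k
    by (simp_all add: N_def)
  define X where "X h k = fst (fst (N h k))" for h k
  define Z where "Z h k = snd (fst (N h k))" for h k
  define l where "l h k = snd (N h k)" for h k
  have NX: "N h k = ((X h k, Z h k), l h k)" for h k
    by (simp add: X_def Z_def l_def)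
  have K: "(X h k, Z h k) \<in> K" for h k
  proof (induction k)
    case 0
    then show ?case using p0 by (simp add: X_def Z_def N0)
  next
    case (Suc k)
    then have "fst (N h (Suc k)) \<in> K"
      using G(1)[of "X h k" "Z h k" "l h k" "h k"] NX[of h k] by (simp add: NS)
    then show ?case by (simp add: X_def Z_def)
  qed
  have step: "X h (Suc k) \<in> cyl (l h k) (X h k)" "Z h (Suc k) \<in> cyl (l h k) (Z h k)" 
    and lS: "l h k < l h (Suc k)" for h k
  proof -
    have "fst (N h (Suc k)) \<in> cyl (l h k) (X h k) \<times> cyl (l h k) (Z h k)" "l h k < snd (N h (Suc k))"
      using G(1,2)[OF K[of h k], where n = "l h k" and i = "h k"] NX[of h k] by (simp_all add: NS)
    then show "X h (Suc k) \<in> cyl (l h k) (X h k)" "Z h (Suc k) \<in> cyl (l h k) (Z h k)"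
      "l h k < l h (Suc k)"
      by (simp_all add: X_def Z_def l_def mem_Times_iff)
  qed
  have lmono: "j \<le> k \<Longrightarrow> l h j \<le> l h k" for h j k
    by (rule lift_Suc_mono_le[of "l h"]) (simp_all add: lS less_imp_le)
  have lge: "k \<le> l h k" for h k
  proof (induction k)
    case (Suc k)
    then show ?case using lS[of h k] by linarith
  qed simp
  have stepX: "X h (j + d) \<in> cyl (l h j) (X h j)" and stepZ: "Z h (j + d) \<in> cyl (l h j) (Z h j)" for h j d
  proof (induction d)
    case (Suc d)
    have lj: "l h j \<le> l h (j + d)" using lmono by simp
    { case 1 then show ?case using Suc(1) step(1)[of h "j + d"] lj by (simp add: cyl_def) }
    { case 2 then show ?case using Suc(2) step(2)[of h "j + d"] lj by (simp add: cyl_def) }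
  qed auto
  \<comment> \<open>Coordinate \<open>i\<close> is settled at node \<open>Suc i\<close>, whose
    length is at least \<open>Suc i\<close>. Node \<open>i\<close> would not do: the root has length
    0.\<close>
  define f where "f h i = X h (Suc i) i" for h i
  define g where "g h i = Z h (Suc i) i" for h i
  have stab: "X h k i = f h i" "Z h k i = g h i" if "i < l h k" for h k i
  proof -
    have i: "i < l h (Suc i)" using lge[of "Suc i" h] by simp
    have "X h k i = X h (Suc i) i \<and> Z h k i = Z h (Suc i) i"
    proof (cases "k \<le> Suc i")
      case True
      then show ?thesis using stepX[of h k "Suc i - k"] stepZ[of h k "Suc i - k"] that
        by (simp add: cyl_def)
    next
      case False
      then show ?thesis using stepX[of h "Suc i" "k - Suc i"] stepZ[of h "Suc i" "k - Suc i"] i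
        by (simp add: cyl_def)
    qed
    then show "X h k i = f h i" "Z h k i = g h i" by (simp_all add: f_def g_def)
  qed
  \<comment> \<open>Node \<open>n\<close> lies in \<open>K\<close> and agrees with the limit on the
    first \<open>n\<close> coordinates, so closedness puts the limit in \<open>K\<close>.\<close>
  have inK: "(f h, g h) \<in> K" for h
  proof (rule ccontr)
    assume "(f h, g h) \<notin> K"
    then obtain n where n: "cyl n (f h) \<times> cyl n (g h) \<subseteq> - K"
      using assms(1) unfolding closed_def open_Baire_prod_iff by (meson ComplI)
    have "(X h n, Z h n) \<in> cyl n (f h) \<times> cyl n (g h)"
      using stab lge[of n h] by (auto simp: cyl_def)
    then show False using n K by blast
  qed
  have fcyl: "f h \<in> cyl (l h k) (X h k)" for h k
    using stab by (simp add: cyl_def)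
  have "inj f"
  proof (rule injI, rule ccontr)
    fix h h' :: "nat \<Rightarrow> bool" assume eq: "f h = f h'" and "h \<noteq> h'"
    then have ex: "\<exists>n. h n \<noteq> h' n" by auto
    \<comment> \<open>Up to the first disagreement both branches share their nodes; the next nodes
      are siblings, whose disjoint cylinders contain the two limits.\<close>
    define n where "n = (LEAST n. h n \<noteq> h' n)"
    have n: "h n \<noteq> h' n" unfolding n_def using ex by (rule LeastI_ex)
    have less: "h i = h' i" if "i < n" for i
      using that not_less_Least unfolding n_def by blast
    have "k \<le> n \<Longrightarrow> N h k = N h' k" for k
      by (induction k) (simp_all add: N0 NS less)
    then have same: "N h n = N h' n" by simp
    have dis: "cyl (l a (Suc n)) (X a (Suc n)) \<inter> cyl (l b (Suc n)) (X b (Suc n)) = {}"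
      if "N a n = N b n" "a n" "\<not> b n" for a b
    proof -
      have "N a (Suc n) = G (N a n) True" "N b (Suc n) = G (N a n) False"
        using that by (simp_all add: NS)
      then show ?thesis
        using G(3)[OF K[of a n], of "l a n", folded NX] by (simp add: l_def X_def)
    qed
    have "cyl (l h (Suc n)) (X h (Suc n)) \<inter> cyl (l h' (Suc n)) (X h' (Suc n)) = {}"
      using dis[of h h'] dis[of h' h] same n by (cases "h n") auto
    then show False using fcyl[of h "Suc n"] fcyl[of h' "Suc n"] eq by auto
  qed
  moreover have "range f \<subseteq> fst ` K" using inK by force
  ultimately show ?thesis by blast
qed

text \<open>In what remains of \<open>C\<close> after the countable pieces are discarded, every
  neighbourhood of a point has uncountable projection, hence two points with different first
  coordinates, as the scheme requires.\<close>

lemma analytic_perfect_set: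
  assumes "analytic A" "uncountable A"
  shows "\<exists>f :: (nat \<Rightarrow> bool) \<Rightarrow> (nat \<Rightarrow> nat). inj f \<and> range f \<subseteq> A"
proof -
  obtain C :: "((nat \<Rightarrow> nat) \<times> (nat \<Rightarrow> nat)) set" where C: "closed C" "A = fst ` C"
    using assms(1) unfolding analytic_def by blast
  obtain B :: "((nat \<Rightarrow> nat) \<times> (nat \<Rightarrow> nat)) set set"
    where B: "countable B" "\<And>S. S \<in> B \<Longrightarrow> open S" "\<And>S. open S \<Longrightarrow> \<exists>\<U>. \<U> \<subseteq> B \<and> S = \<Union>\<U>"
    using univ_second_countable by metis
  \<comment> \<open>Cantor--Bendixson step: discard the basic open pieces of \<open>C\<close> with countable projection.\<close>
  define S where "S = \<Union>{b \<in> B. countable (fst ` (C \<inter> b))}"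
  define K where "K = C - S"
  have "open S" unfolding S_def using B(2) by auto
  then have "closed K" unfolding K_def by (intro closed_Diff C(1))
  have "fst ` (C \<inter> S) = (\<Union>b\<in>{b \<in> B. countable (fst ` (C \<inter> b))}. fst ` (C \<inter> b))"
    unfolding S_def by blast
  then have cS: "countable (fst ` (C \<inter> S))"
    using B(1) by (auto intro!: countable_UN)
  \<comment> \<open>Otherwise a basic \<open>b\<close> with \<open>p\<close> in \<open>b\<close> and
    \<open>b\<close> inside \<open>U\<close> would meet \<open>C\<close> in a set with countable
    projection, and \<open>p\<close> would have been discarded.\<close>
  have unc: "uncountable (fst ` (K \<inter> U))" if "open U" "p \<in> K" "p \<in> U" for U p
  proof
    assume "countable (fst ` (K \<inter> U))"
    obtain \<U> where \<U>: "\<U> \<subseteq> B" "U = \<Union>\<U>"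
      using B(3)[OF \<open>open U\<close>] by (elim exE conjE)
    with \<open>p \<in> U\<close> obtain b where b: "b \<in> B" "p \<in> b" "b \<subseteq> U"
      by auto
    have "fst ` (C \<inter> b) \<subseteq> fst ` (K \<inter> U) \<union> fst ` (C \<inter> S)"
      using b(3) unfolding K_def by blast
    then have "countable (fst ` (C \<inter> b))"
      by (rule countable_subset) (simp add: \<open>countable (fst ` (K \<inter> U))\<close> cS)
    then have "p \<in> S" using b(1,2) unfolding S_def by auto
    then show False using \<open>p \<in> K\<close> by (simp add: K_def)
  qed
  have "\<exists>f :: (nat \<Rightarrow> bool) \<Rightarrow> (nat \<Rightarrow> nat). inj f \<and> range f \<subseteq> fst ` K"
  proof (rule perfect_scheme[OF \<open>closed K\<close>])
    have "A \<subseteq> fst ` K \<union> fst ` (C \<inter> S)" unfolding C(2) K_def by blast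
    then show "K \<noteq> {}" using assms(2) cS countable_subset[of A "fst ` (C \<inter> S)"] by auto
  next
    fix x z n assume "(x, z) \<in> K"
    then have "uncountable (fst ` (K \<inter> cyl n x \<times> cyl n z))"
      by (intro unc[of _ "(x, z)"]) (simp_all add: open_Times open_cyl)
    then have "\<not> fst ` (K \<inter> cyl n x \<times> cyl n z) \<subseteq> {x}"
      using countable_subset[of _ "{x}"] by auto
    then obtain p where "p \<in> K \<inter> cyl n x \<times> cyl n z" "fst p \<noteq> fst (x, z)"
      by auto
    moreover have "(x, z) \<in> K \<inter> cyl n x \<times> cyl n z" using \<open>(x, z) \<in> K\<close> by simp
    ultimately show "\<exists>p\<in>K \<inter> cyl n x \<times> cyl n z. \<exists>q\<in>K \<inter> cyl n x \<times> cyl n z. fst p \<noteq> fst q"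
      by (intro bexI)
  qed
  then show ?thesis unfolding C(2) K_def by blast
qed

section \<open>The pseudo-ultrametrics attached to points of Baire space\<close>

definition first_diff :: "(nat \<Rightarrow> real) \<Rightarrow> (nat \<Rightarrow> 'a) \<Rightarrow> (nat \<Rightarrow> 'a) \<Rightarrow> real" where
  "first_diff r x y = (if x = y then 0 else r (LEAST n. x n \<noteq> y n))"

text \<open>The value 0 outside \<open>M\<close> follows the convention of
  \<open>pseudo_ultrametric_on\<close>.\<close>

definition fibre_dist ::
    "'b set \<Rightarrow> ('b \<Rightarrow> nat \<Rightarrow> 'a) \<Rightarrow> (nat \<Rightarrow> real) \<Rightarrow> (nat \<Rightarrow> 'a) \<Rightarrow> 'b \<Rightarrow> 'b \<Rightarrow> real" where
  "fibre_dist M b r x u v =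
     (if u \<notin> M \<or> v \<notin> M \<or> u = v then 0
      else if b u = b v then first_diff r x (b u) else r 0)"

text \<open>Either \<open>w\<close> leaves the common cylinder before \<open>n\<close>, and then at
  the same index for \<open>x\<close> and \<open>y\<close>, or both first differences have index at
  least \<open>n\<close>. The \<open>max 0\<close> covers the value 0 at equality, since no sign of
  \<open>r\<close> is assumed.\<close>

lemma first_diff_cyl:
  assumes "y \<in> cyl n x" "decseq r"
  shows "first_diff r x w = first_diff r y w \<or>
    first_diff r x w \<le> max 0 (r n) \<and> first_diff r y w \<le> max 0 (r n)"
proof (cases "w \<in> cyl n x")
  case True
  have le: "first_diff r v w \<le> max 0 (r n)" if "w \<in> cyl n v" for v
  proof (cases "v = w")
    case False
    then have "v (LEAST n. v n \<noteq> w n) \<noteq> w (LEAST n. v n \<noteq> w n)"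
      using LeastI_ex[of "\<lambda>n. v n \<noteq> w n"] by (simp add: fun_eq_iff)
    moreover have "v i = w i" if "i < n" for i
      using \<open>w \<in> cyl n v\<close> that by (simp add: cyl_def)
    ultimately have "n \<le> (LEAST n. v n \<noteq> w n)"
      by (meson not_le)
    then show ?thesis using False \<open>decseq r\<close> by (simp add: first_diff_def decseqD le_max_iff_disj)
  qed (simp add: first_diff_def)
  have "w \<in> cyl n y" using True cyl_eq[OF assms(1)] by simp
  then show ?thesis using le[of x] le[of y] True by simp
next
  case False
  then obtain i where i: "i < n" "w i \<noteq> x i" by (auto simp: cyl_def)
  have same: "x j = y j" if "j < n" for j using assms(1) that by (auto simp: cyl_def)
  have L: "(LEAST m. x m \<noteq> w m) = (LEAST m. y m \<noteq> w m)"
  proof (rule Least_equality)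
    have e: "y i \<noteq> w i" using i same by auto
    then have l: "(LEAST m. y m \<noteq> w m) \<le> i" by (rule Least_le[of "\<lambda>m. y m \<noteq> w m"])
    have "y (LEAST m. y m \<noteq> w m) \<noteq> w (LEAST m. y m \<noteq> w m)" using e
      by (rule LeastI[of "\<lambda>m. y m \<noteq> w m"])
    then show "x (LEAST m. y m \<noteq> w m) \<noteq> w (LEAST m. y m \<noteq> w m)"
      using l i(1) same by auto
    fix j assume j: "x j \<noteq> w j"
    show "(LEAST m. y m \<noteq> w m) \<le> j"
    proof (cases "j < n")
      case True
      then show ?thesis using j same by (intro Least_le) simp
    next
      case False
      then show ?thesis using l i(1) by linarith
    qed
  qed
  have "x \<noteq> w" "y \<noteq> w" using i same by auto
  then show ?thesis using L by (simp add: first_diff_def)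
qed

lemma UD_le:
  assumes "\<epsilon> \<in> R"
    and "\<And>x y. x \<in> topspace X \<Longrightarrow> y \<in> topspace X \<Longrightarrow> d x y \<le> max (e x y) \<epsilon>"
    and "\<And>x y. x \<in> topspace X \<Longrightarrow> y \<in> topspace X \<Longrightarrow> e x y \<le> max (d x y) \<epsilon>"
  shows "UD X R d e \<le> ennreal \<epsilon>"
proof -
  have "ennreal a \<le> max (ennreal b) (ennreal \<epsilon>)" if "a \<le> max b \<epsilon>" for a b
    using that by (auto simp: le_max_iff_disj intro: ennreal_leI)
  then show ?thesis unfolding UD_def using assms by (intro Inf_lower) simp
qed

text \<open>The assumption \<open>twin\<close> makes \<Phi> fail to separate points whenever its
  parameter is a value of \<open>b\<close>.\<close>

locale fibre_ultrametric =
  fixes Z :: "'b topology" and b :: "'b \<Rightarrow> nat \<Rightarrow> nat" and R :: "real set" and r :: "nat \<Rightarrow> real"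
  assumes discrete: "Z = discrete_topology (topspace Z)"
    and zero_in: "0 \<in> R" and rR: "\<And>n. r n \<in> R" and rpos: "\<And>n. 0 < r n"
    and dec: "decseq r" and lim: "r \<longlonglongrightarrow> 0"
    and twin: "\<And>u. u \<in> topspace Z \<Longrightarrow> \<exists>v\<in>topspace Z. v \<noteq> u \<and> b v = b u"
begin

abbreviation \<Phi> :: "(nat \<Rightarrow> nat) \<Rightarrow> 'b \<Rightarrow> 'b \<Rightarrow> real" where
  "\<Phi> \<equiv> fibre_dist (topspace Z) b r"

lemma first_diff_bounds: "0 \<le> first_diff r x y" "first_diff r x y \<le> r 0" "first_diff r x y \<in> R"
  "first_diff r x y = 0 \<longleftrightarrow> x = y"
  using rpos[of "LEAST n. x n \<noteq> y n"] rpos[of 0] decseqD[OF dec, of 0 "LEAST n. x n \<noteq> y n"]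
    zero_in rR
  by (simp_all add: first_diff_def)

lemma \<Phi>_nonneg: "0 \<le> \<Phi> x u v"
  using first_diff_bounds(1)[of x "b v"] rpos[of 0] by (simp add: fibre_dist_def)

lemma \<Phi>_in_UCPM: "\<Phi> x \<in> UCPM Z R"
proof -
  \<comment> \<open>Distinct points of one fibre are all equally far apart, and different fibres are
    at the maximal distance \<open>r 0\<close>.\<close>
  have tri: "\<Phi> x u w \<le> max (\<Phi> x u v) (\<Phi> x v w)"
    if "u \<in> topspace Z" "v \<in> topspace Z" "w \<in> topspace Z" for u v w
    using first_diff_bounds(1)[of x "b u"] first_diff_bounds(2)[of x "b u"] rpos[of 0] that
    by (cases "b u = b w"; cases "b u = b v"; cases "u = v"; cases "v = w")
      (simp_all add: fibre_dist_def le_max_iff_disj)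
  have "pseudo_ultrametric_on (topspace Z) (\<Phi> x)"
    unfolding pseudo_ultrametric_on_def
  proof (intro conjI ballI allI impI)
    show "0 \<le> \<Phi> x u v" for u v
      by (rule \<Phi>_nonneg)
    show "\<Phi> x u w \<le> max (\<Phi> x u v) (\<Phi> x v w)"
      if "u \<in> topspace Z" "v \<in> topspace Z" "w \<in> topspace Z" for u v w
      using that by (rule tri)
  qed (auto simp: fibre_dist_def)
  moreover have "continuous_map (prod_topology Z Z) (top_of_set {0..}) (\<lambda>(u, v). \<Phi> x u v)"
  proof -
    have "prod_topology Z Z = discrete_topology (topspace Z \<times> topspace Z)"
      by (rule arg_cong2[where f = prod_topology, OF discrete discrete,
            unfolded prod_topology_discrete_topology[symmetric]])
    then show ?thesis using \<Phi>_nonneg by (simp add: Pi_iff split_beta)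
  qed
  moreover have "\<Phi> x u v \<in> R" for u v
    using zero_in rR first_diff_bounds(3)[of x "b v"] by (simp add: fibre_dist_def)
  ultimately show ?thesis by (simp add: UCPM_def)
qed

lemma \<Phi>_in_UMet_iff: "\<Phi> x \<in> UMet Z R \<longleftrightarrow> x \<notin> b ` topspace Z"
proof
  assume "\<Phi> x \<in> UMet Z R"
  then interpret Metric_space "topspace Z" "\<Phi> x" by (simp add: UMet_def)
  show "x \<notin> b ` topspace Z"
  proof
    assume "x \<in> b ` topspace Z"
    then obtain u v where "u \<in> topspace Z" "v \<in> topspace Z" "v \<noteq> u" "b u = x" "b v = x"
      using twin by blast
    then show False using zero[of u v] by (simp add: fibre_dist_def first_diff_def)
  qed
next
  assume x: "x \<notin> b ` topspace Z"
  have P: "pseudo_ultrametric_on (topspace Z) (\<Phi> x)"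
    using \<Phi>_in_UCPM by (simp add: UCPM_def)
  have pos: "\<Phi> x u v = 0 \<longleftrightarrow> u = v" if "u \<in> topspace Z" "v \<in> topspace Z" for u v
    using that x first_diff_bounds(4) rpos[of 0] by (auto simp: fibre_dist_def)
  interpret Metric_space "topspace Z" "\<Phi> x"
  proof
    show "0 \<le> \<Phi> x u v" for u v
      by (rule \<Phi>_nonneg)
    show "\<Phi> x u v = \<Phi> x v u" for u v
      by (simp add: fibre_dist_def)
    show "\<Phi> x u w \<le> \<Phi> x u v + \<Phi> x v w"
      if "u \<in> topspace Z" "v \<in> topspace Z" "w \<in> topspace Z" for u v w
    proof -
      have "\<Phi> x u w \<le> max (\<Phi> x u v) (\<Phi> x v w)" "0 \<le> \<Phi> x u v" "0 \<le> \<Phi> x v w"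
        using P that unfolding pseudo_ultrametric_on_def by blast+
      then show ?thesis by linarith
    qed
  qed (rule pos)
  have "openin mtopology {u}" if u: "u \<in> topspace Z" for u
  proof -
    \<comment> \<open>The radius is the distance from \<open>u\<close> to the rest of its fibre;
      other fibres are at \<open>r 0\<close>, which is no smaller, and the ball is open.\<close>
    have "mball u (first_diff r x (b u)) \<subseteq> {u}"
      using first_diff_bounds(2)[of x "b u"] by (auto simp: fibre_dist_def split: if_splits)
    moreover have "0 < first_diff r x (b u)"
      using first_diff_bounds(1,4)[of x "b u"] x u by (auto simp: less_le)
    ultimately show ?thesis using u unfolding openin_mtopology by blast
  qed
  then have "discrete_topology (topspace Z) = mtopology"
    by (simp add: discrete_topology_unique)
  then have "mtopology = Z" by (rule trans[OF sym discrete[symmetric]])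
  then show "\<Phi> x \<in> UMet Z R"
    using \<Phi>_in_UCPM Metric_space_axioms by (simp add: UMet_def)
qed

text \<open>Continuity of \<Phi>: parameters agreeing below \<open>n\<close> give
  pseudo-ultrametrics at \<open>UD\<close>-distance at most \<open>r n\<close>, and \<open>r\<close>
  tends to 0.\<close>

lemma open_vimage_\<Phi>:
  assumes "openin (UCPM_topology Z R) U" shows "open (\<Phi> -` U)"
  unfolding open_Baire_iff
proof
  fix x assume "x \<in> \<Phi> -` U"
  then obtain \<epsilon> where \<epsilon>: "\<epsilon> > 0" "{e \<in> UCPM Z R. UD Z R (\<Phi> x) e < \<epsilon>} \<subseteq> U"
    using assms unfolding openin_UCPM_topology by blast
  have "(\<lambda>n. ennreal (r n)) \<longlonglongrightarrow> ennreal 0"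
    using lim by (rule tendsto_ennrealI)
  then have "eventually (\<lambda>n. ennreal (r n) < \<epsilon>) sequentially"
    using \<epsilon>(1) by (intro order_tendstoD(2)) auto
  then obtain n where n: "ennreal (r n) < \<epsilon>"
    by (auto simp: eventually_sequentially)
  have "\<Phi> y \<in> U" if y: "y \<in> cyl n x" for y
  proof -
    have m: "max 0 (r n) = r n" using rpos[of n] by simp
    have "\<Phi> x u v \<le> max (\<Phi> y u v) (r n) \<and> \<Phi> y u v \<le> max (\<Phi> x u v) (r n)" for u v
      using first_diff_cyl[OF y dec, of "b u"] rpos[of n] unfolding m
      by (auto simp: fibre_dist_def)
    then have "UD Z R (\<Phi> x) (\<Phi> y) \<le> ennreal (r n)"
      using rR by (intro UD_le) auto
    then show ?thesis using \<epsilon>(2) n \<Phi>_in_UCPM by (auto intro: le_less_trans)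
  qed
  then show "\<exists>n. cyl n x \<subseteq> \<Phi> -` U" by blast
qed

lemma vimage_borel:
  assumes "S \<in> borel_sets_of (UCPM_topology Z R)"
  shows "\<Phi> -` S \<in> sigma_sets UNIV {U. open U}"
  using assms unfolding borel_sets_of_def topspace_UCPM_topology
proof induction
  case (Basic U)
  then show ?case by (auto intro: open_vimage_\<Phi>)
next
  case Empty
  then show ?case by (simp add: sigma_sets.Empty)
next
  case (Compl S)
  have "\<Phi> -` (UCPM Z R - S) = UNIV - \<Phi> -` S" using \<Phi>_in_UCPM by auto
  then show ?case using sigma_sets.Compl[OF Compl.IH] by simp
next
  case (Union S)
  then show ?case by (simp add: vimage_UN sigma_sets.Union)
qed

lemma analytic_range:
  assumes "UMet Z R \<in> borel_sets_of (UCPM_topology Z R)"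
  shows "analytic (b ` topspace Z)"
proof -
  have "b ` topspace Z = UNIV - \<Phi> -` UMet Z R" using \<Phi>_in_UMet_iff by auto
  then show ?thesis using sigma_sets.Compl[OF vimage_borel[OF assms]] borel_imp_analytic by simp
qed

end

section \<open>Distance values, cardinalities and the conclusion\<close>

lemma characteristic_range_set_sequence:
  assumes "characteristic_range_set R"
  obtains r :: "nat \<Rightarrow> real" where "\<And>n. r n \<in> R" "\<And>n. 0 < r n" "decseq r" "r \<longlonglongrightarrow> 0"
proof -
  have R: "\<exists>s. s \<in> R \<and> 0 < s \<and> s \<le> t" if t: "0 < t" for t
  proof -
    obtain s where "s \<in> R" "s \<noteq> 0" "s \<le> t"
      using assms t unfolding characteristic_range_set_def by blast
    moreover have "0 \<le> s"
      using assms \<open>s \<in> R\<close> unfolding characteristic_range_set_def range_set_def by auto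
    ultimately show ?thesis by (intro exI[of _ s]) simp
  qed
  \<comment> \<open>Halving at each step yields both monotonicity and convergence to 0.\<close>
  have "\<exists>r. \<forall>n::nat. (r n \<in> R \<and> 0 < r n) \<and> r (Suc n) \<le> r n / 2"
  proof (rule dependent_nat_choice)
    show "\<exists>s. s \<in> R \<and> 0 < s" using R[of 1] by auto
    show "\<exists>y. (y \<in> R \<and> 0 < y) \<and> y \<le> x / 2" if "x \<in> R \<and> 0 < x" for x and n :: nat
      using R[of "x / 2"] that by auto
  qed
  then obtain r where r: "\<And>n::nat. r n \<in> R" "\<And>n. 0 < r n" "\<And>n. r (Suc n) \<le> r n / 2" by auto
  have "r (Suc n) \<le> r n" for n
    using r(2)[of n] r(3)[of n] by linarith
  then have "decseq r" by (rule decseq_SucI)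
  have "r n \<le> r 0 * (1/2) ^ n" for n
  proof (induction n)
    case (Suc n)
    then show ?case using r(3)[of n] by simp
  qed simp
  moreover have "(\<lambda>n. r 0 * (1/2) ^ n) \<longlonglongrightarrow> 0"
    by (intro tendsto_mult_right_zero LIMSEQ_power_zero) simp
  ultimately have "r \<longlonglongrightarrow> 0"
    by (intro Lim_null_comparison[of r]) (simp_all add: r(2)[THEN less_imp_le])
  with r \<open>decseq r\<close> show ?thesis using that by blast
qed

text \<open>A sequence is determined by its graph, coded as a set of natural numbers.\<close>

lemma inj_Baire_Cantor: "\<exists>f :: (nat \<Rightarrow> nat) \<Rightarrow> (nat \<Rightarrow> bool). inj f"
proof (intro exI injI ext)
  fix x y :: "nat \<Rightarrow> nat" and n
  assume eq: "(\<lambda>m. x (fst (prod_decode m)) = snd (prod_decode m)) =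
    (\<lambda>m. y (fst (prod_decode m)) = snd (prod_decode m))"
  show "x n = y n" using fun_cong[OF eq, of "prod_encode (n, x n)"] by simp
qed

theorem theorem3p12:
  fixes R :: "real set" and Z :: "'a topology"
  assumes "characteristic_range_set R"
    and "Z = discrete_topology (topspace Z)"
    and "|topspace Z| =o cardSuc natLeq"
  shows "UMet Z R \<notin> borel_sets_of (UCPM_topology Z R)"
proof
  assume borel: "UMet Z R \<in> borel_sets_of (UCPM_topology Z R)"
  let ?Z = "topspace Z"
  have "natLeq <o |?Z|"
    using cardSuc_greater[OF natLeq_Card_order] ordIso_symmetric[OF assms(3)]
    by (rule ordLess_ordIso_trans)
  then have unc: "uncountable ?Z"
    by (simp add: countable_card_le_natLeq not_ordLeq_iff_ordLess natLeq_Well_order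
      card_of_Well_order)
  then have "infinite ?Z" using countable_finite by blast
  obtain r where r: "\<And>n. r n \<in> R" "\<And>n::nat. 0 < r n" "decseq r" "r \<longlonglongrightarrow> 0"
    using characteristic_range_set_sequence[OF assms(1)] by blast
  \<comment> \<open>Identifying \<open>?Z\<close> with two copies of itself doubles every point, so
    any map \<open>a\<close> acquires twins without a change of image.\<close>
  have "|UNIV :: bool set| \<le>o |?Z|"
    using \<open>infinite ?Z\<close> by (intro ordLess_imp_ordLeq finite_ordLess_infinite) (simp_all add: card_of_well_order_on Field_card_of)
  then have "|?Z \<times> (UNIV :: bool set)| =o |?Z|"
    using card_of_Times_infinite[OF \<open>infinite ?Z\<close>, of "UNIV :: bool set"] by simp
  then obtain g where g: "bij_betw g ?Z (?Z \<times> (UNIV :: bool set))"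
    using card_of_ordIso ordIso_symmetric by blast
  have analytic: "analytic (a ` ?Z)" for a :: "'a \<Rightarrow> nat \<Rightarrow> nat"
  proof -
    have gi: "g ` ?Z = ?Z \<times> UNIV" using g by (simp add: bij_betw_def)
    interpret fibre_ultrametric Z "\<lambda>u. a (fst (g u))" R r
    proof
      show "Z = discrete_topology ?Z" by (rule assms(2))
      show "0 \<in> R" using assms(1) by (simp add: characteristic_range_set_def range_set_def)
      fix u assume "u \<in> ?Z"
      \<comment> \<open>The twin of \<open>u\<close> is its other copy, obtained by flipping the
        Boolean.\<close>
      then have "(fst (g u), \<not> snd (g u)) \<in> g ` ?Z" 
        using imageI[of u ?Z g] unfolding gi by (simp add: mem_Times_iff)
      then obtain v where "v \<in> ?Z" "g v = (fst (g u), \<not> snd (g u))" by (metis imageE)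
      moreover from this have "v \<noteq> u" by (metis snd_conv)
      ultimately show "\<exists>v\<in>?Z. v \<noteq> u \<and> a (fst (g v)) = a (fst (g u))"
        by (intro bexI[of _ v]) simp_all
    qed (simp_all add: r)
    have "(\<lambda>u. a (fst (g u))) ` ?Z = a ` fst ` g ` ?Z" by (simp add: image_image)
    also have "\<dots> = a ` ?Z" using gi by simp
    finally show ?thesis using analytic_range[OF borel] by simp
  qed
  obtain D where D: "\<not> analytic D" using ex_not_analytic by blast
  then have "D \<noteq> {}" using analytic_closed[of "{}"] by auto
  show False
  proof (cases "|D| \<le>o |?Z|")
    case True
    then obtain a where "a ` ?Z = D" unfolding card_of_ordLeq2[OF \<open>D \<noteq> {}\<close>, symmetric] ..
    then show False using analytic[of a] D by simp
  next
    case False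
    have less: "|?Z| <o |D|" 
      using False not_ordLeq_iff_ordLess[OF card_of_Well_order card_of_Well_order] by (rule iffD1[rotated])
    obtain a where a: "inj_on a ?Z" "a ` ?Z \<subseteq> D"
      using ordLess_imp_ordLeq[OF less] unfolding card_of_ordLeq[symmetric] by (elim exE conjE)
    \<comment> \<open>The image of \<open>a\<close> is analytic and uncountable, so it contains a
      copy of Cantor space. As \<open>D\<close> embeds there through \<open>h\<close>, this forces
      \<open>D\<close> to be no larger than \<open>?Z\<close>.\<close>
    have "uncountable (a ` ?Z)" using unc a(1) by (simp add: countable_image_inj_eq)
    then obtain f :: "(nat \<Rightarrow> bool) \<Rightarrow> nat \<Rightarrow> nat" where f: "inj f" "range f \<subseteq> a ` ?Z"
      using analytic_perfect_set[OF analytic[of a]] by auto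
    obtain h :: "(nat \<Rightarrow> nat) \<Rightarrow> nat \<Rightarrow> bool" where h: "inj h"
      using inj_Baire_Cantor ..
    have "inj_on (f \<circ> h) D" 
      using inj_compose[OF f(1) h] by (rule inj_on_subset) simp
    moreover have "(f \<circ> h) ` D \<subseteq> a ` ?Z" using f(2) by auto
    ultimately have "|D| \<le>o |a ` ?Z|" unfolding card_of_ordLeq[symmetric] by (intro exI conjI)
    then show False using False ordLeq_transitive[OF _ card_of_image] by metis
  qed
qed

end
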